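(* Let $n$ be a positive integer. Let $\{\sigma_k\}$ be the second order recurrence given by \[ \sigma_k=3\sigma_{k-1}-\sigma_{k-2}+F_{n+4k-1}+F_{2k-1}F_{n+2k},\qquad k\ge 2, \] with $\sigma_0=0$ and $\sigma_1=3F_{n+2}$. Let $\{\rho_k\}$ be the related sequence given by \[ \rho_k=\sigma_k-2\sigma_{k-1}-F_{2k+1}F_{n+2k},\qquad k\ge 2. \] If $S=\langle F_n,F_{n+2},F_{n+4},\ldots\rangle$ and $\mathbf{e}(S)=\kappa$, then \[ \mathbf{g}(S)=\begin{cases}\dfrac{\sigma_{\kappa-2}+\rho_{\kappa-1}}{F_n}-\dfrac{F_n-1}{2} & \text{if } n=2\kappa-1,\\[8pt] \dfrac{\sigma_{\kappa-1}}{F_n}-\dfrac{F_n-1}{2} & \text{if } n=2\kappa.\end{cases} \]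
   Context: For a set $A$ of positive integers, $\langle A\rangle$ denotes the set of all finite linear combinations of elements of $A$ with non-negative integer coefficients. The embedding dimension $\mathbf{e}(S)$ is the size of the minimal set of generators of $S$, i.e. of $S^{\star}\setminus(S^{\star}+S^{\star})$ where $S^{\star}=S\setminus\{0\}$. The genus $\mathbf{g}(S)$ is the cardinality of $\mathbb{Z}_{\ge 0}\setminus S$. $F_m$ denotes the Fibonacci sequence: $F_0=0$, $F_1=F_2=1$, $F_m=F_{m-1}+F_{m-2}$. *)

theory Defs
  imports Complex_Main "HOL-Number_Theory.Fib"
begin

definition generated :: "nat set \<Rightarrow> nat set"  (\<open>\<langle>_\<rangle>\<close>) where
  "\<langle>A\<rangle> = {\<Sum>a\<in>B. c a * a | B c. finite B \<and> B \<subseteq> A}"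

definition min_generators :: "nat set \<Rightarrow> nat set" where
  "min_generators S = (S - {0}) - {a + b | a b. a \<in> S - {0} \<and> b \<in> S - {0}}"

definition embedding_dim :: "nat set \<Rightarrow> nat" where
  "embedding_dim S = card (min_generators S)"

definition genus :: "nat set \<Rightarrow> nat" where
  "genus S = card (UNIV - S)"

definition fib_semigroup :: "nat \<Rightarrow> nat set" where
  "fib_semigroup n = \<langle>{fib (n + 2 * i) | i. True}\<rangle>"

fun sigma_nat :: "nat \<Rightarrow> nat \<Rightarrow> int" where
  "sigma_nat n 0 = 0"
| "sigma_nat n (Suc 0) = 3 * int (fib (n + 2))"
| "sigma_nat n (Suc (Suc j)) = (let k = Suc (Suc j) in
     3 * sigma_nat n (k - 1) - sigma_nat n (k - 2)
     + int (fib (n + 4 * k - 1)) + int (fib (2 * k - 1)) * int (fib (n + 2 * k)))"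

text \<open>
  The genus formula for \<open>n = 2\<kappa> - 1\<close> involves \<open>\<sigma>\<^sub>-\<^sub>1\<close> when \<open>\<kappa> = 1\<close>. This term is obtained by
  running the recurrence backwards, that is, by solving its instance \<open>k = 1\<close> for \<open>\<sigma>\<^sub>-\<^sub>1\<close>.
  The values at indices below \<open>-1\<close> are arbitrary and never used.
\<close>

definition sigma :: "nat \<Rightarrow> int \<Rightarrow> int" where
  "sigma n i = (if i < 0
     then 3 * sigma_nat n 0 - sigma_nat n 1 + int (fib (n + 3)) + int (fib 1) * int (fib (n + 2))
     else sigma_nat n (nat i))"

text \<open>
  The formula is used for every \<open>k \<ge> 0\<close>, not only for \<open>k \<ge> 2\<close>, since \<open>\<rho>\<^sub>1\<close> and \<open>\<rho>\<^sub>0\<close> occur in the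
  genus formula for \<open>n = 3\<close> and \<open>n = 1\<close>.
\<close>

definition rho :: "nat \<Rightarrow> nat \<Rightarrow> int" where
  "rho n k = sigma n (int k) - 2 * sigma n (int k - 1)
     - int (fib (2 * k + 1)) * int (fib (n + 2 * k))"

lemma sigma_0: "sigma n 0 = 0"
  by (simp add: sigma_def)

lemma sigma_1: "sigma n 1 = 3 * int (fib (n + 2))"
  by (simp add: sigma_def)

lemma sigma_rec:
  assumes "k \<ge> 1"
  shows "sigma n (int k) = 3 * sigma n (int k - 1) - sigma n (int k - 2)
     + int (fib (n + 4 * k - 1)) + int (fib (2 * k - 1)) * int (fib (n + 2 * k))"
proof (cases "k = 1")
  case True
  then show ?thesis
    by (simp add: sigma_def add.commute)
next
  case False
  with assms have k: "k = Suc (Suc (k - 2))"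
    by linarith
  have i: "\<not> int k < 0" "\<not> int k - 1 < 0" "\<not> int k - 2 < 0"
    "nat (int k) = k" "nat (int k - 1) = k - 1" "nat (int k - 2) = k - 2"
    using k by linarith+
  have "sigma_nat n k = 3 * sigma_nat n (k - 1) - sigma_nat n (k - 2)
     + int (fib (n + 4 * k - 1)) + int (fib (2 * k - 1)) * int (fib (n + 2 * k))"
    using sigma_nat.simps(3)[of n "k - 2"] unfolding Let_def k[symmetric] .
  then show ?thesis
    unfolding sigma_def if_not_P[OF i(1)] if_not_P[OF i(2)] if_not_P[OF i(3)] i(4-6) .
qed

end

theory Submission
  imports Defs "HOL-Number_Theory.Cong"
begin

text \<open>
  Since \<open>F\<^bsub>n+2i\<^esub> = F\<^bsub>2i\<^esub> F\<^bsub>n-1\<^esub> + F\<^bsub>2i+1\<^esub> F\<^bsub>n\<^esub>\<close>, the semigroup is the image under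
  \<open>(x, z) \<mapsto> x F\<^bsub>n-1\<^esub> + z F\<^bsub>n\<^esub>\<close> of the monoid generated by the vectors \<open>(F\<^bsub>2i\<^esub>, F\<^bsub>2i+1\<^esub>)\<close>. Consecutive
  vectors are unimodular, so this monoid consists of all lattice points in an increasing union of
  cones, and for \<open>x < F\<^bsub>n\<^esub>\<close> membership simplifies to \<open>F\<^bsub>n+1\<^esub> x \<le> F\<^bsub>n\<^esub> z\<close>. With \<open>a = F\<^bsub>n\<^esub>\<close> and
  \<open>b = F\<^bsub>n-1\<^esub>\<close> the least elements of \<open>S\<close> in the residue classes modulo \<open>a\<close> (the Apery set) are
  therefore \<open>x b + a \<lceil>x (a + b) / a\<rceil>\<close> for \<open>0 \<le> x < a\<close>, and summing gives
  \<open>2 g(S) = (a - 1) (a + 2 b)\<close>. On the other side, induction gives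
  \<open>2 \<sigma>\<^sub>k = (F\<^bsub>2k+2\<^esub> - 1) (F\<^bsub>n+2k+2\<^esub> + F\<^bsub>n\<^esub>)\<close>, also for \<open>k = -1\<close>.
\<close>

section \<open>Fibonacci identities and monotonicity\<close>

lemma fib_det: "fib (2 * i + 1) * fib (2 * i + 2) = fib (2 * i) * fib (2 * i + 3) + 1"
proof (induction i)
  case (Suc i)
  then show ?case
    by (simp add: algebra_simps numeral_3_eq_3)
qed (simp add: numeral_3_eq_3)

text \<open>The determinant identity \<open>fib_det\<close> rewritten as a quadratic form in two
  consecutive terms, the shape in which it later serves as a side relation for
  \<open>algebra\<close>.\<close>

lemma fib_Cassini_odd:
  "int (fib (2 * i + 1)) ^ 2 - int (fib (2 * i + 1)) * int (fib (2 * i)) - int (fib (2 * i)) ^ 2 = 1"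
proof -
  have "int (fib (2 * i + 1) * fib (2 * i + 2)) = int (fib (2 * i) * fib (2 * i + 3) + 1)"
    using fib_det by simp
  then show ?thesis
    by (simp add: algebra_simps numeral_3_eq_3 power2_eq_square)
qed

text \<open>For \<open>m = 2 * i\<close> this exhibits \<open>(fib m, fib (Suc m))\<close> as
  coordinates of a generator with respect to \<open>fib p\<close> and
  \<open>fib (Suc p)\<close>.\<close>

lemma fib_Suc_add: "fib (Suc p + m) = fib m * fib p + fib (Suc m) * fib (Suc p)"
  using fib_add[of p m] by simp

lemma fib_less_imp_less: "fib m < fib n \<Longrightarrow> m < n"
  by (metis fib_mono not_less)

section \<open>Sums of generators\<close>

lemma generated_add:
  assumes "s \<in> \<langle>A\<rangle>" and "t \<in> \<langle>A\<rangle>"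
  shows "s + t \<in> \<langle>A\<rangle>"
proof -
  from assms obtain B c C d where B: "finite B" "B \<subseteq> A" "s = (\<Sum>a\<in>B. c a * a)"
    and C: "finite C" "C \<subseteq> A" "t = (\<Sum>a\<in>C. d a * a)"
    unfolding generated_def by blast
  define e where "e a = (if a \<in> B then c a else 0) + (if a \<in> C then d a else 0)" for a
  have "s = (\<Sum>a\<in>B \<union> C. (if a \<in> B then c a else 0) * a)"
    unfolding B(3) using B(1) C(1) by (intro sum.mono_neutral_cong_left) auto
  moreover have "t = (\<Sum>a\<in>B \<union> C. (if a \<in> C then d a else 0) * a)"
    unfolding C(3) using B(1) C(1) by (intro sum.mono_neutral_cong_left) auto
  ultimately have "s + t = (\<Sum>a\<in>B \<union> C. e a * a)"
    by (simp add: e_def sum.distrib distrib_right)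
  then show ?thesis
    unfolding generated_def using B(1,2) C(1,2) by blast
qed

lemma generated_mult:
  assumes "a \<in> A"
  shows "k * a \<in> \<langle>A\<rangle>"
proof -
  have "k * a = (\<Sum>x\<in>{a}. k * x) \<and> finite {a} \<and> {a} \<subseteq> A"
    using assms by simp
  then show ?thesis
    unfolding generated_def by (intro CollectI exI[of _ "{a}"] exI[of _ "\<lambda>_. k"])
qed

lemma generated_induct [consumes 1, case_names zero add]:
  assumes "s \<in> \<langle>A\<rangle>"
    and "P 0"
    and "\<And>a t. a \<in> A \<Longrightarrow> t \<in> \<langle>A\<rangle> \<Longrightarrow> P t \<Longrightarrow> P (a + t)"
  shows "P s"
proof -
  from assms(1) obtain B c where B: "finite B" "B \<subseteq> A" "s = (\<Sum>a\<in>B. c a * a)"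
    unfolding generated_def by blast
  \<comment> \<open>Membership is carried along because the rule for \<open>add\<close> also asks
    for it. The inner induction below adds the copies of \<open>b\<close> one at a time.\<close>
  have "P (\<Sum>a\<in>B. c a * a) \<and> (\<Sum>a\<in>B. c a * a) \<in> \<langle>A\<rangle>"
    using B(1,2)
  proof (induction B)
    case empty
    have "0 \<in> \<langle>A\<rangle>"
      unfolding generated_def by (rule CollectI, rule exI[of _ "{}"]) auto
    then show ?case
      using assms(2) by simp
  next
    case (insert b B)
    have "P (k * b + (\<Sum>a\<in>B. c a * a)) \<and> k * b + (\<Sum>a\<in>B. c a * a) \<in> \<langle>A\<rangle>" for k
    proof (induction k)
      case 0
      then show ?case using insert by simp
    next
      case (Suc k)
      then show ?case
        using insert.prems assms(3)[of b] generated_add[OF generated_mult[of b A 1]]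
        by (auto simp: add.assoc)
    qed
    then show ?case
      using insert by simp
  qed
  then show ?thesis
    using B(3) by simp
qed

section \<open>Lattice points in cones\<close>

text \<open>The natural points between the rays through \<open>(0, 1)\<close> and
  \<open>(fib (2 * i), fib (2 * i + 1))\<close>, with the slope condition cleared of
  denominators.\<close>

definition cone :: "nat \<Rightarrow> nat \<Rightarrow> nat \<Rightarrow> bool" where
  "cone i x z \<longleftrightarrow> fib (2 * i + 1) * x \<le> fib (2 * i) * z"

text \<open>By \<open>fib_det\<close> the ratios \<open>fib (2 * i) / fib (2 * i + 1)\<close>
  increase with \<open>i\<close>. The comparison cancels a factor \<open>fib (2 * i)\<close>, so the
  degenerate cone \<open>i = 0\<close>, where \<open>x = 0\<close>, is treated apart.\<close>

lemma cone_Suc: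
  assumes "cone i x z"
  shows "cone (Suc i) x z"
proof (cases "i = 0")
  case True
  then show ?thesis using assms by (simp add: cone_def)
next
  case False
  then have pos: "fib (2 * i) > 0"
    by (simp add: fib_neq_0_nat)
  have "fib (2 * i) * (fib (2 * i + 3) * x) \<le> (fib (2 * i + 1) * fib (2 * i + 2)) * x"
    unfolding fib_det by (simp add: algebra_simps)
  also have "\<dots> = fib (2 * i + 2) * (fib (2 * i + 1) * x)"
    by (simp only: ac_simps)
  also have "\<dots> \<le> fib (2 * i + 2) * (fib (2 * i) * z)"
    using assms unfolding cone_def by (rule mult_le_mono2)
  also have "\<dots> = fib (2 * i) * (fib (2 * i + 2) * z)"
    by (simp only: ac_simps)
  finally have "fib (2 * i + 3) * x \<le> fib (2 * i + 2) * z"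
    using pos nat_mult_le_cancel1 by blast
  then show ?thesis
    by (simp add: cone_def numeral_3_eq_3)
qed

lemma cone_mono: "cone i x z \<Longrightarrow> i \<le> j \<Longrightarrow> cone j x z"
  by (induction j) (auto simp: le_Suc_eq intro: cone_Suc)

lemma cone_add: "cone i x z \<Longrightarrow> cone i x' z' \<Longrightarrow> cone i (x + x') (z + z')"
  by (simp add: cone_def distrib_left add_mono)

lemma cone_generator: "j \<le> i \<Longrightarrow> cone i (k * fib (2 * j)) (k * fib (2 * j + 1))"
  by (rule cone_mono[of j]) (simp_all add: cone_def mult.commute mult.left_commute)

text \<open>Consecutive vectors \<open>(F\<^bsub>2j\<^esub>, F\<^bsub>2j+1\<^esub>)\<close> have determinant one, so the lattice points between
  them are their natural combinations, with coefficients given by Cramer's rule.\<close>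

lemma cone_decomp:
  assumes "cone i x z"
  obtains j a b where "x = a * fib (2 * j) + b * fib (2 * j + 2)"
    and "z = a * fib (2 * j + 1) + b * fib (2 * j + 3)"
proof -
  have "\<exists>j a b. x = a * fib (2 * j) + b * fib (2 * j + 2)
      \<and> z = a * fib (2 * j + 1) + b * fib (2 * j + 3)"
    using assms
  proof (induction i)
    case 0
    then have "x = 0 * fib (2 * 0 + 2) + z * fib (2 * 0)" by (simp add: cone_def)
    then show ?case by (intro exI[of _ 0] exI[of _ z]) auto
  next
    case (Suc i)
    show ?case
    proof (cases "cone i x z")
      case True
      then show ?thesis by (rule Suc.IH)
    next
      case False
      let ?f = "\<lambda>k. int (fib (2 * i + k))"
      define a where "a = fib (2 * i + 2) * z - fib (2 * i + 3) * x"
      define b where "b = fib (2 * i + 1) * x - fib (2 * i) * z"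
      \<comment> \<open>The point lies in cone \<open>Suc i\<close> but not in cone
        \<open>i\<close>, so neither subtraction is truncated.\<close>
      have a: "int a = ?f 2 * int z - ?f 3 * int x"
        using Suc.prems by (simp add: a_def cone_def numeral_3_eq_3 of_nat_diff)
      have b: "int b = ?f 1 * int x - ?f 0 * int z"
        using False by (simp add: b_def cone_def of_nat_diff)
      have det: "?f 1 * ?f 2 = ?f 0 * ?f 3 + 1"
        using arg_cong[OF fib_det[of i], of int] by simp
      have "int x = int a * ?f 0 + int b * ?f 2" "int z = int a * ?f 1 + int b * ?f 3"
        unfolding a b using det by algebra+
      then have "int x = int (a * fib (2 * i) + b * fib (2 * i + 2))"
        "int z = int (a * fib (2 * i + 1) + b * fib (2 * i + 3))"
        by simp_all
      then show ?thesis
        unfolding of_nat_eq_iff by blast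
    qed
  qed
  then show ?thesis using that by blast
qed

text \<open>Adding a generator adds its coordinate vector, and nestedness puts both vectors in one
  cone. Conversely, \<open>cone_decomp\<close> writes a point of a cone with two consecutive
  generators.\<close>

lemma fib_semigroup_eq:
  "fib_semigroup (Suc p) = {x * fib p + z * fib (Suc p) | x z. \<exists>i. cone i x z}"
    (is "_ = ?M")
proof (intro equalityI subsetI)
  fix s assume "s \<in> fib_semigroup (Suc p)"
  then show "s \<in> ?M"
    unfolding fib_semigroup_def
  proof (induction rule: generated_induct)
    case zero
    have "cone 0 0 0" by (simp add: cone_def)
    then show ?case by fastforce
  next
    case (add g t)
    then obtain j i x z where g: "g = fib (Suc p + 2 * j)"
      and t: "t = x * fib p + z * fib (Suc p)" "cone i x z" by blast
    have "cone (max i j) (x + 1 * fib (2 * j)) (z + 1 * fib (2 * j + 1))"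
      by (intro cone_add cone_generator cone_mono[OF t(2)]) auto
    moreover have "g + t = (x + 1 * fib (2 * j)) * fib p + (z + 1 * fib (2 * j + 1)) * fib (Suc p)"
      unfolding g t fib_Suc_add by (simp add: algebra_simps)
    ultimately show ?case by blast
  qed
next
  fix s assume "s \<in> ?M"
  then obtain x z i where s: "s = x * fib p + z * fib (Suc p)" and "cone i x z" by blast
  then obtain j a b where xz: "x = a * fib (2 * j) + b * fib (2 * j + 2)"
      "z = a * fib (2 * j + 1) + b * fib (2 * j + 3)"
    using cone_decomp by metis
  have "s = a * fib (Suc p + 2 * j) + b * fib (Suc p + 2 * Suc j)"
    unfolding s xz fib_Suc_add by (simp add: algebra_simps numeral_3_eq_3)
  then show "s \<in> fib_semigroup (Suc p)"
    unfolding fib_semigroup_def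
    by (simp only:) (intro generated_add generated_mult; blast)
qed

section \<open>Membership test for reduced coordinates\<close>

text \<open>Both sides satisfy the Fibonacci recurrence in \<open>n\<close>, so it suffices to check
  \<open>n = 2 * j\<close>, an equality, and \<open>n = 2 * j + 1\<close>, which is Cassini.\<close>

lemma fib_mult_fib_even_le:
  assumes "2 * j \<le> n"
  shows "fib (n + 1) * fib (2 * j) \<le> fib n * fib (2 * j + 1)"
proof -
  have "fib (2 * j + 1 + d) * fib (2 * j) \<le> fib (2 * j + d) * fib (2 * j + 1)" for d
  proof (induction d rule: fib.induct)
    case 2
    have "int (fib (2 * j + 1)) * int (fib (2 * j + 1)) \<ge> int (fib (2 * j + 1 + 1)) * int (fib (2 * j))"
      using fib_Cassini_odd[of j] by (simp add: algebra_simps power2_eq_square)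
    then show ?case
      unfolding of_nat_mult[symmetric] of_nat_le_iff by simp
  qed (simp_all add: algebra_simps)
  from this[of "n - 2 * j"] assms show ?thesis by simp
qed

text \<open>The bound on \<open>x\<close> admits only vectors with \<open>2 * i \<le> n\<close> in a
  decomposition, and these all satisfy the inequality. Conversely, the inequality puts the point in
  the cone of index \<open>n / 2\<close> rounded up.\<close>

lemma cone_iff:
  assumes "x < fib n"
  shows "(\<exists>i. cone i x z) \<longleftrightarrow> fib (n + 1) * x \<le> fib n * z"
proof
  assume "\<exists>i. cone i x z"
  then obtain j a b where xz: "x = a * fib (2 * j) + b * fib (2 * j + 2)"
      "z = a * fib (2 * j + 1) + b * fib (2 * j + 3)"
    using cone_decomp by metis
  have *: "k * (fib (n + 1) * fib (2 * i)) \<le> k * (fib n * fib (2 * i + 1))"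
    if "k * fib (2 * i) \<le> x" for k i
  proof (cases "k = 0")
    case False
    then have "fib (2 * i) < fib n"
      using that assms by (cases k) auto
    then have "2 * i \<le> n"
      using fib_less_imp_less by fastforce
    then show ?thesis
      by (intro mult_le_mono2 fib_mult_fib_even_le)
  qed simp
  have "fib (n + 1) * x = a * (fib (n + 1) * fib (2 * j)) + b * (fib (n + 1) * fib (2 * Suc j))"
    unfolding xz by (simp add: algebra_simps)
  also have "\<dots> \<le> a * (fib n * fib (2 * j + 1)) + b * (fib n * fib (2 * Suc j + 1))"
    by (intro add_mono *) (simp_all add: xz)
  also have "\<dots> = fib n * z"
    unfolding xz by (simp add: algebra_simps numeral_3_eq_3)
  finally show "fib (n + 1) * x \<le> fib n * z" .
next
  assume le: "fib (n + 1) * x \<le> fib n * z"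
  show "\<exists>i. cone i x z"
  proof (cases "even n")
    case True
    then show ?thesis
      using le by (intro exI[of _ "n div 2"]) (simp add: cone_def)
  next
    case False
    \<comment> \<open>For odd \<open>n\<close> the half plane is slightly wider than the cone. The
      excess in the Cassini identity is just \<open>x < fib n\<close>, which integrality
      absorbs.\<close>
    then have i: "2 * ((n + 1) div 2) = n + 1" by simp
    have "fib (n + 2) * fib n = fib (n + 1) * fib (n + 1) + 1"
      using fib_Cassini_nat[of n] False by (simp add: power2_eq_square)
    then have "fib n * (fib (n + 2) * x) = fib (n + 1) * (fib (n + 1) * x) + x"
      by (metis mult.commute mult.left_commute distrib_right mult_1)
    also have "\<dots> < fib (n + 1) * (fib n * z) + fib n"
      using le assms by (intro add_le_less_mono mult_le_mono2)
    also have "\<dots> = fib n * (fib (n + 1) * z + 1)" by (simp add: algebra_simps)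
    finally have "fib (n + 2) * x < fib (n + 1) * z + 1"
      by (simp only: nat_mult_less_cancel_disj)
    then show ?thesis
      by (intro exI[of _ "(n + 1) div 2"]) (simp only: cone_def i, simp)
  qed
qed

text \<open>Reducing \<open>x\<close> modulo \<open>fib (Suc p)\<close> and moving the multiples
  into \<open>z\<close> keeps the sum, lowers \<open>x\<close> and raises \<open>z\<close>, so the
  point stays in its cone.\<close>

lemma mem_fib_semigroup_iff:
  "N \<in> fib_semigroup (Suc p) \<longleftrightarrow>
    (\<exists>x z. x < fib (Suc p) \<and> N = x * fib p + z * fib (Suc p)
      \<and> fib (Suc p + 1) * x \<le> fib (Suc p) * z)"
proof
  assume "N \<in> fib_semigroup (Suc p)"
  then obtain i x z where N: "N = x * fib p + z * fib (Suc p)" and c: "cone i x z"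
    unfolding fib_semigroup_eq by blast
  define a where "a = fib (Suc p)"
  have "a > 0" by (simp add: a_def fib_neq_0_nat)
  define x' z' where "x' = x mod a" and "z' = z + x div a * fib p"
  have "x * fib p = (x' + x div a * a) * fib p"
    unfolding x'_def by (rule arg_cong[of _ _ "\<lambda>k. k * fib p"]) simp
  then have "N = x' * fib p + z' * a"
    unfolding N z'_def a_def[symmetric] by (simp add: algebra_simps)
  moreover have "cone i x' z'"
  proof -
    have "fib (2 * i + 1) * x' \<le> fib (2 * i + 1) * x" by (simp add: x'_def)
    also have "\<dots> \<le> fib (2 * i) * z" using c by (simp only: cone_def)
    also have "\<dots> \<le> fib (2 * i) * z'" by (simp add: z'_def)
    finally show ?thesis by (simp only: cone_def)
  qed
  moreover have "x' < a" using \<open>a > 0\<close> by (simp add: x'_def)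
  ultimately show "\<exists>x z. x < fib (Suc p) \<and> N = x * fib p + z * fib (Suc p)
      \<and> fib (Suc p + 1) * x \<le> fib (Suc p) * z"
    using cone_iff[of x' "Suc p" z'] unfolding a_def by blast
next
  assume "\<exists>x z. x < fib (Suc p) \<and> N = x * fib p + z * fib (Suc p)
      \<and> fib (Suc p + 1) * x \<le> fib (Suc p) * z"
  then show "N \<in> fib_semigroup (Suc p)"
    unfolding fib_semigroup_eq using cone_iff by blast
qed

section \<open>Counting gaps by residue classes\<close>

text \<open>Here \<open>w x\<close> is the least element of \<open>S\<close> in its class modulo
  \<open>a\<close>, and \<open>w x div a\<close> smaller numbers share that class. Injectivity on a
  finite set makes every class occur once.\<close>

lemma card_compl_apery:
  fixes a :: nat and w :: "nat \<Rightarrow> nat"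
  assumes "a > 0" and inj: "inj_on (\<lambda>x. w x mod a) {..<a}"
    and mem: "\<And>N. N \<in> S \<longleftrightarrow> (\<exists>x<a. w x \<le> N \<and> N mod a = w x mod a)"
  shows "card (UNIV - S) = (\<Sum>x<a. w x div a)"
proof -
  define G where "G x = (\<lambda>k. w x mod a + a * k) ` {..<w x div a}" for x
  have G: "N \<in> G x \<longleftrightarrow> N < w x \<and> N mod a = w x mod a" for N x
  proof
    assume "N \<in> G x"
    then obtain k where k: "N = w x mod a + a * k" "k < w x div a"
      by (auto simp: G_def)
    then have "a * k < a * (w x div a)" using \<open>a > 0\<close> by simp
    then have "N < w x"
      using k(1) mod_mult_div_eq[of "w x" a] by linarith
    moreover have "N mod a = w x mod a"
      by (simp add: k(1))
    ultimately show "N < w x \<and> N mod a = w x mod a" ..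
  next
    assume N: "N < w x \<and> N mod a = w x mod a"
    have "\<not> w x div a \<le> N div a"
    proof
      assume "w x div a \<le> N div a"
      then have "a * (w x div a) \<le> a * (N div a)" by simp
      then show False
        using N mod_mult_div_eq[of "w x" a] mod_mult_div_eq[of N a] by linarith
    qed
    moreover have "N = w x mod a + a * (N div a)"
      using N mod_mult_div_eq[of N a] by simp
    ultimately show "N \<in> G x"
      unfolding G_def by (intro image_eqI[of _ _ "N div a"]) auto
  qed
  have surj: "(\<lambda>x. w x mod a) ` {..<a} = {..<a}"
    using \<open>a > 0\<close> by (intro endo_inj_surj inj) auto
  have "UNIV - S = (\<Union>x\<in>{..<a}. G x)"
  proof (intro equalityI subsetI)
    fix N assume N: "N \<in> UNIV - S"
    have "N mod a \<in> (\<lambda>x. w x mod a) ` {..<a}"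
      unfolding surj using \<open>a > 0\<close> by simp
    then obtain x where "x < a" "N mod a = w x mod a" by auto
    then show "N \<in> (\<Union>x\<in>{..<a}. G x)"
      using N mem[of N] by (auto simp: G not_le)
  next
    fix N assume "N \<in> (\<Union>x\<in>{..<a}. G x)"
    then obtain x where x: "x < a" "N < w x" "N mod a = w x mod a" by (auto simp: G)
    have "y = x" if "y < a" "N mod a = w y mod a" for y
      using inj_onD[OF inj, of y x] that x by simp
    then show "N \<in> UNIV - S"
      using x mem[of N] by auto
  qed
  also have "card \<dots> = (\<Sum>x<a. card (G x))"
  proof (rule card_UN_disjoint)
    show "\<forall>x\<in>{..<a}. \<forall>y\<in>{..<a}. x \<noteq> y \<longrightarrow> G x \<inter> G y = {}"
    proof (intro ballI impI, rule ccontr)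
      fix x y assume xy: "x \<in> {..<a}" "y \<in> {..<a}" "x \<noteq> y" "G x \<inter> G y \<noteq> {}"
      then obtain N where "N \<in> G x" "N \<in> G y" by blast
      then have "w x mod a = w y mod a" by (simp add: G)
      then show False using inj_onD[OF inj] xy by blast
    qed
  qed (auto simp: G_def)
  also have "\<dots> = (\<Sum>x<a. w x div a)"
    unfolding G_def using \<open>a > 0\<close> by (intro sum.cong refl, subst card_image) (auto simp: inj_on_def)
  finally show ?thesis .
qed

text \<open>The terms for \<open>x\<close> and \<open>a - x\<close> add up to \<open>a + 2b\<close>.\<close>

lemma sum_floor_coprime:
  fixes a b :: nat
  assumes "a > 0" and "coprime a b"
  shows "2 * (\<Sum>x\<in>{1..<a}. x + 2 * (x * b div a) + 1) = (a - 1) * (a + 2 * b)"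
proof -
  define g where "g x = x + 2 * (x * b div a) + 1" for x
  have pair: "g x + g (a - x) = a + 2 * b" if "x \<in> {1..<a}" for x
  proof -
    define q r where "q = x * b div a" and "r = x * b mod a"
    have xb: "x * b = a * q + r" by (simp add: q_def r_def)
    have "r < a" using \<open>a > 0\<close> by (simp add: r_def)
    have "r > 0"
    proof (rule ccontr)
      assume "\<not> r > 0"
      then have "a dvd x * b" by (simp add: r_def mod_eq_0_iff_dvd)
      then have "a dvd x" using assms(2) by (simp add: coprime_dvd_mult_left_iff)
      then show False using that by (auto dest: dvd_imp_le)
    qed
    have "a * q < a * b"
    proof -
      have "b > 0" using xb \<open>r > 0\<close> by (cases b) auto
      then have "x * b < a * b" using that by simp
      then show ?thesis using xb by linarith
    qed
    then have "q < b" by (simp only: nat_mult_less_cancel_disj)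
    \<comment> \<open>Since \<open>r > 0\<close>, the product \<open>(a - x) * b\<close> has
      quotient \<open>b - q - 1\<close> and remainder \<open>a - r\<close>. The additive forms below
      avoid truncated subtraction.\<close>
    define d y t where "d = b - q - 1" and "y = a - x" and "t = a - r"
    have d: "b = q + 1 + d" and y: "a = x + y" and t: "a = r + t"
      using \<open>q < b\<close> \<open>r < a\<close> that by (auto simp: d_def y_def t_def)
    have "y * b + x * b = a * q + a + a * d"
      unfolding y d by (simp add: algebra_simps)
    then have "y * b = a * d + t" using xb t by linarith
    then have "y * b div a = d" using t \<open>r > 0\<close> by (intro div_nat_eqI) auto
    moreover have "a - x = y" using y by simp
    ultimately show ?thesis
      unfolding g_def q_def[symmetric] using y d by simp
  qed
  have "(\<Sum>x\<in>{1..<a}. g x) = (\<Sum>x\<in>{1..<a}. g (a - x))"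
    by (rule sum.reindex_bij_witness[of _ "\<lambda>x. a - x" "\<lambda>x. a - x"]) auto
  then have "2 * (\<Sum>x\<in>{1..<a}. g x) = (\<Sum>x\<in>{1..<a}. g x + g (a - x))"
    by (simp add: sum.distrib)
  also have "\<dots> = (\<Sum>x\<in>{1..<a}. a + 2 * b)"
    by (intro sum.cong refl pair)
  finally show ?thesis
    by (simp add: g_def)
qed

lemma genus_fib_semigroup:
  "2 * genus (fib_semigroup (Suc p)) = (fib (Suc p) - 1) * (fib (Suc p) + 2 * fib p)"
proof -
  define a b where "a = fib (Suc p)" and "b = fib p"
  have "a > 0" by (simp add: a_def fib_neq_0_nat)
  have cop: "coprime a b"
    using coprime_fib_Suc_nat[of p] by (simp add: a_def b_def coprime_commute)
  \<comment> \<open>This is the ceiling of \<open>x * (a + b) / a\<close> for \<open>x < a\<close>: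
    if \<open>x > 0\<close>, then \<open>a\<close> does not divide \<open>x * b\<close>, so the
    ceiling is the floor plus one.\<close>
  define z where "z x = (if x = 0 then 0 else x + x * b div a + 1)" for x
  define w where "w x = x * b + z x * a" for x
  have z: "z x \<le> k \<longleftrightarrow> (a + b) * x \<le> a * k" if "x < a" for x k
  proof (cases "x = 0")
    case False
    have "x * b mod a \<noteq> 0"
    proof
      assume "x * b mod a = 0"
      then have "a dvd x" using cop by (simp add: mod_eq_0_iff_dvd coprime_dvd_mult_left_iff)
      then show False using that False by (auto dest: dvd_imp_le)
    qed
    then have xb: "a * (x * b div a) < x * b"
      using mult_div_mod_eq[of a "x * b"] by linarith
    have xb': "x * b < a * (x * b div a) + a"
      using mult_div_mod_eq[of a "x * b"] mod_less_divisor[OF \<open>a > 0\<close>, of "x * b"] by linarith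
    show ?thesis
    proof
      assume "z x \<le> k"
      then have "a * (x + x * b div a + 1) \<le> a * k"
        using False by (intro mult_le_mono2) (simp add: z_def)
      then show "(a + b) * x \<le> a * k" using xb' by (simp add: algebra_simps)
    next
      assume "(a + b) * x \<le> a * k"
      then have "a * (x + x * b div a) < a * k" using xb by (simp add: algebra_simps)
      then show "z x \<le> k" using False by (simp add: z_def)
    qed
  qed (simp add: z_def)
  have "card (UNIV - fib_semigroup (Suc p)) = (\<Sum>x<a. w x div a)"
  proof (rule card_compl_apery[OF \<open>a > 0\<close>])
    show "inj_on (\<lambda>x. w x mod a) {..<a}"
    proof (rule inj_onI)
      fix x y assume xy: "x \<in> {..<a}" "y \<in> {..<a}" "w x mod a = w y mod a"
      then have "[x * b = y * b] (mod a)" by (simp add: w_def cong_def)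
      then have "[x = y] (mod a)"
        using cop by (simp add: cong_mult_rcancel_nat coprime_commute)
      then show "x = y" using xy by (simp add: cong_def)
    qed
    fix N
    have "N \<in> fib_semigroup (Suc p) \<longleftrightarrow> (\<exists>x k. x < a \<and> N = x * b + k * a \<and> z x \<le> k)"
      unfolding mem_fib_semigroup_iff using z by (simp add: a_def b_def add.commute) metis
    also have "\<dots> \<longleftrightarrow> (\<exists>x<a. w x \<le> N \<and> N mod a = w x mod a)"
    proof safe
      fix x k assume "x < a" "z x \<le> k"
      then show "\<exists>y<a. w y \<le> x * b + k * a \<and> (x * b + k * a) mod a = w y mod a"
        by (intro exI[of _ x]) (simp add: w_def)
    next
      fix x assume x: "x < a" "w x \<le> N" "N mod a = w x mod a"
      then have "a dvd N - w x" by (simp add: mod_eq_dvd_iff_nat)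
      then obtain d where "N - w x = a * d" by (elim dvdE)
      then have "N = x * b + (z x + d) * a" using x(2) by (simp add: w_def algebra_simps)
      then show "\<exists>x k. x < a \<and> N = x * b + k * a \<and> z x \<le> k" using x(1) le_add1 by blast
    qed
    finally show "N \<in> fib_semigroup (Suc p) \<longleftrightarrow> (\<exists>x<a. w x \<le> N \<and> N mod a = w x mod a)" .
  qed
  also have "\<dots> = (\<Sum>x\<in>{1..<a}. w x div a)"
    by (rule sum.mono_neutral_right) (auto simp: w_def z_def)
  also have "\<dots> = (\<Sum>x\<in>{1..<a}. x + 2 * (x * b div a) + 1)"
  proof (intro sum.cong refl)
    fix x assume "x \<in> {1..<a}"
    moreover have "w x div a = z x + x * b div a"
      using \<open>a > 0\<close> by (simp add: w_def)
    ultimately show "w x div a = x + 2 * (x * b div a) + 1"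
      by (simp add: z_def)
  qed
  finally show ?thesis
    unfolding genus_def a_def[symmetric] b_def[symmetric]
    using sum_floor_coprime[OF \<open>a > 0\<close> cop] by simp
qed

section \<open>Closed form of the recurrence\<close>

text \<open>In the step every term is expressed by two consecutive values near \<open>2 * j\<close>
  and two near \<open>n\<close>. What remains is a polynomial identity modulo Cassini.\<close>

lemma sigma_nat_closed:
  "2 * sigma_nat n k = (int (fib (2 * k + 2)) - 1) * (int (fib (n + 2 * k + 2)) + int (fib n))"
proof (induction k rule: fib.induct)
  case 1
  then show ?case by simp
next
  case 2
  then show ?case by (simp add: eval_nat_numeral)
next
  case (3 j)
  define p q f g where "p = int (fib (2 * j))" and "q = int (fib (2 * j + 1))"
    and "f = int (fib n)" and "g = int (fib (n + 1))"
  note defs = this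
  have rel: "q ^ 2 - q * p - p ^ 2 = 1"
    unfolding defs by (rule fib_Cassini_odd)
  have v: "int (fib (n + 2 * j + 1)) = q * g + p * f"
    using arg_cong[OF fib_add[of n "2 * j"], of int] by (simp add: defs)
  have w: "int (fib (n + 2 * j + 2)) = (p + q) * g + q * f"
    using arg_cong[OF fib_add[of n "2 * j + 1"], of int] by (simp add: defs add.commute)
  have F: "int (fib (m + 3)) = int (fib (m + 2)) + int (fib (m + 1))"
     "int (fib (m + 4)) = 2 * int (fib (m + 2)) + int (fib (m + 1))"
     "int (fib (m + 6)) = 5 * int (fib (m + 2)) + 3 * int (fib (m + 1))"
     "int (fib (m + 7)) = 8 * int (fib (m + 2)) + 5 * int (fib (m + 1))" for m
    by (simp_all add: eval_nat_numeral)
  have p2: "int (fib (2 * j + 2)) = p + q"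
    by (simp add: defs)
  \<comment> \<open>This inhomogeneous term is \<open>fib (n + 4 * k - 1)\<close> at
    \<open>k = j + 2\<close>, split by the addition formula.\<close>
  have "fib (n + 4 * j + 7) = q * int (fib (n + 2 * j + 7)) + p * int (fib (n + 2 * j + 6))"
    using arg_cong[OF fib_add[of "n + 2 * j + 6" "2 * j"], of int]
    by (simp add: defs numeral_eq_Suc add.commute add.left_commute)
  moreover have "sigma_nat n (Suc (Suc j)) = 3 * sigma_nat n (Suc j) - sigma_nat n j
      + int (fib (n + 4 * j + 7)) + int (fib (2 * j + 3)) * int (fib (n + 2 * j + 4))"
    by (simp add: eval_nat_numeral)
  ultimately have "2 * sigma_nat n (Suc (Suc j)) =
      3 * (2 * sigma_nat n (Suc j)) - 2 * sigma_nat n j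
      + 2 * (q * int (fib (n + 2 * j + 7)) + p * int (fib (n + 2 * j + 6)))
      + 2 * int (fib (2 * j + 3)) * int (fib (n + 2 * j + 4))"
    by simp
  also have "\<dots> = 3 * ((int (fib (2 * j + 4)) - 1) * (int (fib (n + 2 * j + 4)) + f))
      - (int (fib (2 * j + 2)) - 1) * (int (fib (n + 2 * j + 2)) + f)
      + 2 * (q * int (fib (n + 2 * j + 7)) + p * int (fib (n + 2 * j + 6)))
      + 2 * int (fib (2 * j + 3)) * int (fib (n + 2 * j + 4))"
    using 3 by (simp add: defs numeral_eq_Suc)
  also have "\<dots> = (int (fib (2 * j + 6)) - 1) * (int (fib (n + 2 * j + 6)) + f)"
    unfolding F p2 v w q_def[symmetric] using rel by algebra
  finally show ?case
    by (simp add: defs numeral_eq_Suc)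
qed

text \<open>Index \<open>-1\<close> is included for \<open>n = 1\<close>. There the backward
  recurrence gives \<open>- fib n\<close>, in agreement with \<open>fib 0 = 0\<close>.\<close>

lemma sigma_closed:
  assumes "i \<ge> -1"
  shows "2 * sigma n i = (int (fib (nat (2 * i + 2))) - 1) * (int (fib (nat (int n + 2 * i + 2))) + int (fib n))"
proof (cases "i = -1")
  case True
  have "sigma n (-1) = - int (fib n)"
    by (simp add: sigma_def eval_nat_numeral)
  then show ?thesis
    by (simp add: True)
next
  case False
  then have "0 \<le> i" using assms by simp
  then obtain k where "i = int k" by (rule nonneg_int_cases)
  moreover have "nat (2 * int k + 2) = 2 * k + 2" "nat (int n + 2 * int k + 2) = n + 2 * k + 2"
    by simp_all
  ultimately show ?thesis
    using sigma_nat_closed[of n k] by (simp add: sigma_def)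
qed

section \<open>Minimal generators and embedding dimension\<close>

lemma fib_in_fib_semigroup: "fib (n + 2 * i) \<in> fib_semigroup n"
  using generated_mult[of "fib (n + 2 * i)" "{fib (n + 2 * i) |i. True}" 1]
  unfolding fib_semigroup_def by auto

text \<open>Splitting one generator off a nonzero element leaves either nothing or a nonzero rest,
  and in the latter case the element is decomposable.\<close>

lemma min_generators_subset: "min_generators \<langle>A\<rangle> \<subseteq> A"
proof
  fix s assume s: "s \<in> min_generators \<langle>A\<rangle>"
  then have "s \<in> \<langle>A\<rangle>" by (simp add: min_generators_def)
  then have "s = 0 \<or> s \<in> A \<or> (\<exists>a t. a \<in> \<langle>A\<rangle> - {0} \<and> t \<in> \<langle>A\<rangle> - {0} \<and> s = a + t)"
  proof (induction rule: generated_induct)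
    case (add a t)
    have "a \<in> \<langle>A\<rangle>" using generated_mult[OF add(1), of 1] by simp
    with add show ?case by (cases "a = 0"; cases "t = 0") auto
  qed simp
  with s show "s \<in> A"
    unfolding min_generators_def by blast
qed

text \<open>A generator used with positive coefficient is at most \<open>s\<close>, so only indices
  up to \<open>i\<close> occur.\<close>

lemma fib_semigroup_below:
  assumes "s \<in> fib_semigroup (Suc p)" and less: "s < fib (Suc p + 2 * Suc i)"
  obtains x z where "s = x * fib p + z * fib (Suc p)" and "cone i x z"
proof -
  from assms(1) obtain j a b where s: "s = (a * fib (2 * j) + b * fib (2 * Suc j)) * fib p
      + (a * fib (2 * j + 1) + b * fib (2 * Suc j + 1)) * fib (Suc p)"
    unfolding fib_semigroup_eq
    by (auto elim!: cone_decomp simp: numeral_3_eq_3)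
  then have s': "s = a * fib (Suc p + 2 * j) + b * fib (Suc p + 2 * Suc j)"
    unfolding fib_Suc_add by (simp add: algebra_simps)
  have *: "cone i (k * fib (2 * l)) (k * fib (2 * l + 1))" if "k * fib (Suc p + 2 * l) \<le> s" for k l
  proof (cases "k = 0")
    case False
    then have "fib (Suc p + 2 * l) < fib (Suc p + 2 * Suc i)"
      using that less by (cases k) auto
    then have "Suc p + 2 * l < Suc p + 2 * Suc i"
      by (rule fib_less_imp_less)
    then have "l \<le> i" by simp
    then show ?thesis by (rule cone_generator)
  qed (simp add: cone_def)
  show ?thesis
    by (rule that[OF s]) (intro cone_add *; simp only: s' le_add1 le_add2)
qed

lemma fib_notin_min_generators:
  assumes "2 * i \<ge> Suc p"
  shows "fib (Suc p + 2 * i) \<notin> min_generators (fib_semigroup (Suc p))"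
proof -
  \<comment> \<open>Coordinates of \<open>fib (Suc p + 2 * i) - fib (Suc p)\<close>: shift by
    \<open>(- fib (Suc p), fib p)\<close>, which keeps the value, then subtract
    \<open>(0, 1)\<close>.\<close>
  define x z where "x = fib (2 * i) - fib (Suc p)" and "z = fib (2 * i + 1) + fib p - 1"
  have le: "fib (Suc p) \<le> fib (2 * i)"
    using assms by (rule fib_mono)
  have pos: "fib (Suc p) > 0" "fib (2 * i + 1) > 0" by (simp_all add: fib_neq_0_nat)
  have x: "fib (2 * i) = x + fib (Suc p)" and z: "fib (2 * i + 1) + fib p = z + 1"
    using le pos by (simp_all add: x_def z_def)
  have "fib (2 * i + 1) * x + fib (2 * i) \<le> fib (2 * i + 1) * x + fib (2 * i + 1) * fib (Suc p)"
    using fib_Suc_mono[of "2 * i"] pos(1) by (simp add: mult_le_mono[of _ _ 1, simplified] le_trans)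
  also have "\<dots> = fib (2 * i) * fib (2 * i + 1)"
    unfolding x by (simp add: algebra_simps)
  also have "\<dots> \<le> fib (2 * i) * (z + 1)"
    unfolding z[symmetric] by simp
  finally have "cone i x z"
    by (simp add: cone_def)
  then have mem: "x * fib p + z * fib (Suc p) \<in> fib_semigroup (Suc p)"
    unfolding fib_semigroup_eq by blast
  have "(fib (2 * i) * fib p) + fib (2 * i + 1) * fib (Suc p)
      = x * fib p + (fib (2 * i + 1) + fib p) * fib (Suc p)"
    unfolding x by (simp add: algebra_simps)
  then have eq: "fib (Suc p + 2 * i) = (x * fib p + z * fib (Suc p)) + fib (Suc p)"
    unfolding z fib_Suc_add by simp
  have "i \<ge> 1" using assms by (cases i) auto
  then have "z > 0"
    using fib_mono[of 3 "2 * i + 1"] by (simp add: z_def numeral_3_eq_3)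
  then have "x * fib p + z * fib (Suc p) \<in> fib_semigroup (Suc p) - {0}"
    using mem pos by simp
  moreover have "fib (Suc p) \<in> fib_semigroup (Suc p) - {0}"
    using fib_in_fib_semigroup[of "Suc p" 0] pos by simp
  ultimately show ?thesis
    unfolding min_generators_def eq by blast
qed

text \<open>For \<open>i > 0\<close>, nonzero summands lie in the cone of index
  \<open>i - 1\<close>, hence so does their sum. The coordinates of the sum are forced to be
  \<open>(fib (2 * i), fib (2 * i + 1))\<close>, which \<open>fib_det\<close> excludes from that
  cone.\<close>

lemma fib_in_min_generators:
  assumes "2 * i < Suc p"
  shows "fib (Suc p + 2 * i) \<in> min_generators (fib_semigroup (Suc p))"
proof -
  let ?S = "fib_semigroup (Suc p)"
  have False if st: "s \<in> ?S" "t \<in> ?S" "s > 0" "t > 0" "fib (Suc p + 2 * i) = s + t" for s t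
  proof -
    have less: "s < fib (Suc p + 2 * i)" "t < fib (Suc p + 2 * i)"
      using st by auto
    show False
    proof (cases i)
      \<comment> \<open>No earlier cone exists here; instead every nonzero element is at least
        \<open>fib (Suc p)\<close>.\<close>
      case 0
      from st(1) obtain j x z where s: "s = x * fib p + z * fib (Suc p)" and c: "cone j x z"
        unfolding fib_semigroup_eq by blast
      have "z \<noteq> 0"
      proof
        assume "z = 0"
        then have "x = 0"
          using c fib_neq_0_nat[of "2 * j + 1"] by (simp add: cone_def)
        with \<open>z = 0\<close> s st(3) show False by simp
      qed
      then show False using s less(1) 0 by (cases z) auto
    next
      case (Suc k)
      obtain x z where s: "s = x * fib p + z * fib (Suc p)" "cone k x z"
        using fib_semigroup_below st(1) less(1) unfolding Suc by blast
      obtain x' z' where t: "t = x' * fib p + z' * fib (Suc p)" "cone k x' z'"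
        using fib_semigroup_below st(2) less(2) unfolding Suc by blast
      define X Z where "X = x + x'" and "Z = z + z'"
      have c: "cone k X Z"
        unfolding X_def Z_def using s(2) t(2) by (rule cone_add)
      have eq: "X * fib p + Z * fib (Suc p) = fib (2 * i) * fib p + fib (2 * i + 1) * fib (Suc p)"
        using st(5) unfolding fib_Suc_add s t X_def Z_def by (simp add: algebra_simps)
      define a b where "a = fib (Suc p)" and "b = fib p"
      have cop: "coprime b a"
        unfolding a_def b_def by (rule coprime_fib_Suc_nat)
      have "a > 0" by (simp add: a_def fib_neq_0_nat)
      have fi: "0 < fib (2 * i)" "fib (2 * i) < fib (2 * i + 1)" "fib (2 * i + 1) \<le> a"
        using assms fib_neq_0_nat[of "2 * k + 1"] fib_mono[of "2 * i + 1" "Suc p"]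
        by (simp_all add: Suc a_def)
      have "fib (2 * k + 1) * X \<le> fib (2 * k) * Z"
        using c by (simp only: cone_def)
      also have "\<dots> \<le> fib (2 * k + 1) * Z"
        using fib_Suc_mono[of "2 * k"] by simp
      finally have "X \<le> Z"
        using fib_neq_0_nat[of "2 * k + 1"] by simp
      have eq': "X * b + Z * a = fib (2 * i) * b + fib (2 * i + 1) * a"
        using eq by (simp only: a_def b_def)
      then have "(X * b + Z * a) mod a = (fib (2 * i) * b + fib (2 * i + 1) * a) mod a"
        by (rule arg_cong)
      then have "[X * b = fib (2 * i) * b] (mod a)"
        by (simp add: cong_def)
      then have "X mod a = fib (2 * i) mod a"
        using cop by (simp add: cong_mult_rcancel_nat cong_def[symmetric])
      then have X: "X = fib (2 * i) + a * (X div a)"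
        using fi mod_mult_div_eq[of X a] by simp
      define q where "q = X div a"
      have "a * (q * b + Z) = a * fib (2 * i + 1)"
        using eq' X unfolding q_def[symmetric] by (simp add: algebra_simps)
      then have Z: "q * b + Z = fib (2 * i + 1)"
        using \<open>a > 0\<close> by simp
      \<comment> \<open>Otherwise \<open>X > a \<ge> fib (2 * i + 1) \<ge> Z\<close>, against
        \<open>X \<le> Z\<close>.\<close>
      have "q = 0"
      proof (rule ccontr)
        assume "q \<noteq> 0"
        then have "a \<le> a * q" by simp
        then show False
          using X \<open>X \<le> Z\<close> Z fi unfolding q_def[symmetric] by linarith
      qed
      then have "X = fib (2 * i) \<and> Z = fib (2 * i + 1)"
        using X Z by (simp add: q_def)
      then have "fib (2 * k + 1) * fib (2 * k + 2) \<le> fib (2 * k) * fib (2 * k + 3)"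
        using c by (simp add: cone_def Suc numeral_3_eq_3)
      then show False
        using fib_det[of k] by simp
    qed
  qed
  moreover have "fib (Suc p + 2 * i) \<noteq> 0"
    using fib_neq_0_nat[of "Suc p + 2 * i"] by simp
  ultimately show ?thesis
    unfolding min_generators_def using fib_in_fib_semigroup[of "Suc p" i] by auto
qed

text \<open>The surviving indices are those with \<open>2 * i < Suc p\<close>. Indices advance by
  two, so the coincidence \<open>fib 1 = fib 2\<close> does no harm and the values are
  distinct.\<close>

lemma embedding_dim_fib_semigroup:
  "embedding_dim (fib_semigroup (Suc p)) = (p + 2) div 2"
proof -
  let ?g = "\<lambda>i. fib (Suc p + 2 * i)"
  have "min_generators (fib_semigroup (Suc p)) \<subseteq> range ?g"
    using min_generators_subset[of "{fib (Suc p + 2 * i) |i. True}"]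
    unfolding fib_semigroup_def by blast
  then have "min_generators (fib_semigroup (Suc p)) = ?g ` {i. 2 * i < Suc p}"
    using fib_in_min_generators fib_notin_min_generators not_less by blast
  moreover have "{i. 2 * i < Suc p} = {..<(p + 2) div 2}" by auto
  moreover have "inj_on ?g {..<(p + 2) div 2}"
  proof -
    have step: "?g i < ?g (Suc i)" for i
      using fib_neq_0_nat[of "Suc p + 2 * i"] fib_neq_0_nat[of "Suc (Suc p + 2 * i)"]
      by simp
    have "strict_mono ?g"
      using step by (rule strict_mono_Suc_iff[THEN iffD2, OF allI])
    then show ?thesis
      by (blast intro: inj_on_subset strict_mono_imp_inj_on)
  qed
  ultimately show ?thesis
    by (simp add: embedding_dim_def card_image)
qed

section \<open>The genus formula\<close>

text \<open>Clears denominators, so that both cases become integer polynomial identities.\<close>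

lemma eq_div_minus_halfI:
  assumes "(f::nat) > 0" and "2 * int g * int f = 2 * s - int f * (int f - 1)"
  shows "real g = real_of_int s / real f - (real f - 1) / 2"
proof -
  have "2 * real g * real f = 2 * real_of_int s - real f * (real f - 1)"
    using arg_cong[OF assms(2), of real_of_int] by simp
  then show ?thesis using assms(1) by (simp add: field_simps)
qed

theorem theorem4p11:
  fixes n \<kappa> :: nat and S :: "nat set"
  assumes "n \<ge> 1"
    and "S = fib_semigroup n"
    and "embedding_dim S = \<kappa>"
  shows "(n = 2 * \<kappa> - 1 \<or> n = 2 * \<kappa>)
    \<and> (n = 2 * \<kappa> - 1 \<longrightarrow>
         real (genus S) = real_of_int (sigma n (int \<kappa> - 2) + rho n (\<kappa> - 1)) / real (fib n)
           - (real (fib n) - 1) / 2)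
    \<and> (n = 2 * \<kappa> \<longrightarrow>
         real (genus S) = real_of_int (sigma n (int \<kappa> - 1)) / real (fib n)
           - (real (fib n) - 1) / 2)"
proof -
  obtain p where n: "n = Suc p"
    using assms(1) by (cases n) auto
  define a b where "a = int (fib n)" and "b = int (fib p)"
  have pos: "fib n > 0" by (simp add: n fib_neq_0_nat)
  have \<kappa>: "\<kappa> = (p + 2) div 2"
    using assms(2,3) embedding_dim_fib_semigroup n by simp
  have "int (2 * genus S) = int ((fib n - 1) * (fib n + 2 * fib p))"
    using genus_fib_semigroup[of p] by (simp only: assms(2) n)
  then have g: "2 * int (genus S) = (a - 1) * (a + 2 * b)"
    using pos by (simp add: a_def b_def of_nat_diff)
  have f1: "int (fib (n + 1)) = a + b"
    by (simp add: a_def b_def n)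
  \<comment> \<open>The indices \<open>2 * n\<close>, \<open>2 * n - 1\<close> and
    \<open>2 * n + 1\<close> are those in the second factor of \<open>sigma_closed\<close>.\<close>
  have f2: "int (fib (n + n)) = a * (a + 2 * b)"
    unfolding n fib_Suc_add by (simp add: a_def b_def n algebra_simps)
  have f2m: "int (fib (n + p)) = a * a + b * b"
    unfolding n fib_Suc_add by (simp add: a_def b_def n)
  have f2p: "int (fib (n + (n + 1))) = a * a + (a + b) * (a + b)"
    using f2 f2m by (simp add: n algebra_simps)
  show ?thesis
  proof (cases "even n")
    case True
    \<comment> \<open>The bound \<open>\<kappa> \<ge> 1\<close> keeps the truncated
      \<open>2 * \<kappa> - 1\<close> distinct from \<open>2 * \<kappa>\<close>.\<close>
    then have "n = 2 * \<kappa>" "\<kappa> \<ge> 1" using \<kappa> n by (auto elim: oddE)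
    have i: "nat (2 * (int \<kappa> - 1) + 2) = n" "nat (int n + 2 * (int \<kappa> - 1) + 2) = n + n"
      using \<open>n = 2 * \<kappa>\<close> by auto
    have "2 * sigma n (int \<kappa> - 1) = (a - 1) * (a * (a + 2 * b) + a)"
      using sigma_closed[of "int \<kappa> - 1" n] unfolding i f2 a_def[symmetric] by simp
    then have "real (genus S) = real_of_int (sigma n (int \<kappa> - 1)) / real (fib n) - (real (fib n) - 1) / 2"
      using g by (intro eq_div_minus_halfI[OF pos]) (unfold a_def[symmetric], algebra)
    then show ?thesis
      using \<open>n = 2 * \<kappa>\<close> \<open>\<kappa> \<ge> 1\<close> by auto
  next
    case False
    then have \<kappa>n: "n = 2 * \<kappa> - 1" "\<kappa> \<ge> 1" using \<kappa> n by (auto elim!: evenE)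
    then have k: "2 * \<kappa> = n + 1" by simp
    have i: "nat (2 * (int \<kappa> - 1) + 2) = n + 1" "nat (int n + 2 * (int \<kappa> - 1) + 2) = n + (n + 1)"
      using k by auto
    \<comment> \<open>For \<open>\<kappa> = 1\<close> the index is \<open>-1\<close>, and indeed
      \<open>p = 0\<close>.\<close>
    have j: "nat (2 * (int \<kappa> - 2) + 2) = p" "nat (int n + 2 * (int \<kappa> - 2) + 2) = n + p"
      using k n by auto
    \<comment> \<open>For odd \<open>n\<close> the index \<open>p\<close> is even, which fixes the
      sign in Cassini. The final identity holds modulo this relation.\<close>
    have cassini: "a * a - a * b - b * b = 1"
    proof -
      have "2 * (\<kappa> - 1) = p" using \<kappa>n n by auto
      then show ?thesis
        using fib_Cassini_odd[of "\<kappa> - 1"] by (simp add: a_def b_def n power2_eq_square)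
    qed
    have s1: "2 * sigma n (int \<kappa> - 1) = (a + b - 1) * (a * a + (a + b) * (a + b) + a)"
      using sigma_closed[of "int \<kappa> - 1" n] unfolding i f2p f1 a_def[symmetric] by simp
    have s2: "2 * sigma n (int \<kappa> - 2) = (b - 1) * (a * a + b * b + a)"
      using sigma_closed[of "int \<kappa> - 2" n] \<kappa>n(2) unfolding j f2m a_def[symmetric] b_def[symmetric] by simp
    have "int (\<kappa> - 1) = int \<kappa> - 1" "2 * (\<kappa> - 1) + 1 = n" "n + 2 * (\<kappa> - 1) = n + p"
      using \<kappa>n n by auto
    then have r: "rho n (\<kappa> - 1) = sigma n (int \<kappa> - 1) - 2 * sigma n (int \<kappa> - 2) - a * (a * a + b * b)"
      unfolding rho_def by (simp add: f2m a_def[symmetric])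
    have "real (genus S) = real_of_int (sigma n (int \<kappa> - 2) + rho n (\<kappa> - 1)) / real (fib n)
        - (real (fib n) - 1) / 2"
      using g cassini s1 s2 unfolding r
      by (intro eq_div_minus_halfI[OF pos]) (unfold a_def[symmetric], algebra)
    then show ?thesis
      using \<kappa>n by auto
  qed
qed

end
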